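(* Let $(\mathcal{B}_t,\mathcal{L}_t,\mathbf{P})$ be a market for liquidity at time $t$ and let $i\in\mathcal{L}_t$, $j\in\mathcal{B}_t$ denote lenders and borrowers. Let $\kappa\ge0$ be a Tobin-like tax, i.e. $r^{\kappa}_{ij}=r_i+h_{ij}+\kappa$. Then, under the bilateral contracting mechanism: (i) Any matching $\mu_t$ such that $r^{\kappa}_{ij}<\bar r_j$ for any $\mu_t(i)=j$ and $r^{\kappa}_{ij}<r^{\kappa}_{mj}$ for any (such matched pair and any) $m\in\mathcal{L}_t$ with $\mu_t(m)=m$ is stable (in the market taxed by $\kappa$), i.e. $\mu^{*,\kappa}_t=\mu_t$. Denote by $\mathcal{EQ}^{\kappa}_t$ the set of such equilibria. (ii) The trading volume at time $t$ is bounded as follows: $$\max_{\mu^{*,\kappa}_t\in\mathcal{EQ}^{\kappa}_t}\mathrm{Vol}(\mu^{*,\kappa}_t)\;\le\;\max_{\mu^*_t\in\mathcal{EQ}_t}\mathrm{Vol}(\mu^*_t).$$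
   Context: **Market.** $\mathcal{N}$ is a finite set of banks; $\mathcal{L}_t,\mathcal{B}_t\subseteq\mathcal{N}$ are disjoint sets (potential lenders and potential borrowers); $\mathbf{P}$ is the collection of all preference lists described below. Each lender $i$ has a base rate $r_i$, and the $r_i$ are strictly ordered (pairwise distinct). Each borrower $j$ has a reservation rate $\bar r_j$ and a default probability $\rho_j\in[0,1)$ on a loan of maturity $S\in\{1,2,\dots\}$ periods. All these quantities are given and commonly known. **Bilateral contracting mechanism.** The risk premium is $h_{ij}=\frac{1+r_i}{(1-\rho_j)^{1/S}}-1-r_i$, and without tax the rate paid by $j$ when borrowing from $i$ is $r_{ij}=r_i+h_{ij}$. A Tobin-like tax is a constant $\kappa$ added to every rate; reservation rates and lenders' preferences do not change. **Preferences.** Borrower $j$ prefers an option with a lower rate, where the option "borrow from lender $i$" has rate $r_{ij}$ ($r^{\kappa}_{ij}$ in the taxed market) and the option "stay unmatched" (denoted $j$) has rate $\bar r_j$. Every lender is indifferent among all borrowers. **Matching.** A matching $\mu_t$ is a one-to-one correspondence from $\mathcal{N}$ onto itself with $\mu_t(\mu_t(a))=a$ for all $a$, such that for any $b\in\mathcal{B}_t$, if $\mu_t(b)\neq b$ then $\mu_t(b)\in\mathcal{L}_t$, and for any $l\in\mathcal{L}_t$, if $\mu_t(l)\neq l$ then $\mu_t(l)\in\mathcal{B}_t$. A bank $a$ with $\mu_t(a)=a$ is unmatched. The volume is $\mathrm{Vol}(\mu_t)=\frac12\sum_{i\in\mathcal{L}_t\cup\mathcal{B}_t}\mathbf{1}\{\mu_t(i)\neq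 i\}$. **Stable matching.** A matching $\mu^*$ is stable if: (I) (pairwise deviation) for all $i,l\in\mathcal{L}_t$ and $k,j\in\mathcal{B}_t$ such that $\mu^*(i)=j$ and $\mu^*(k)=l$, it cannot be that both $i$ strictly prefers $k$ to $j$ and $k$ strictly prefers $i$ to $l$; (II) (coalitional deviation) let $\vec b\subseteq\mathcal{B}_t$ be a set of borrowers such that their assigned lenders are indifferent between any borrowers in $\vec b$ (for any $j,k\in\vec b$, lender $\mu^*(j)$ is indifferent between $j$ and $k$); then there cannot be another matching $\mu'$ such that every $j\in\vec b$ strictly prefers $\mu'(j)$ to $\mu^*(j)$ (this condition expresses that no group of borrowing banks can agree to swap counter-parties if their lenders are indifferent); (III) (unilateral deviation) for any $j\in\mathcal{B}_t$ with $\mu^*(j)\neq j$, it cannot be that $j$ strictly prefers staying unmatched to $\mu^*(j)$; and for any $j\in\mathcal{B}_t$, it cannot be that $j$ strictly prefers to $\mu^*(j)$ some $k\in\mathcal{L}_t$ with $\mu^*(k)=k$. **Untaxed equilibria.** $\mathcal{EQ}_t$ is the set of matchings $\mu_t$ such that $r_{ij}<\bar r_j$ for any $\mu_t(i)=j$ ($i\in\mathcal{L}_t$, $j\in\mathcal{B}_t$) and $r_{ij}<r_{kj}$ for any such pair and any $k\in\mathcal{L}_t$ with $\mu_t(k)=k$.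
   Formalization: In (i) it is also assumed that no unmatched borrower's reservation rate exceeds the taxed rate of an unmatched lender (else (III) can fail); condition (II) is read as a nonempty group of matched borrowers swapping their own lenders among themselves. *)

theory Defs
  imports Complex_Main "HOL-Combinatorics.Permutations"
begin

record 'a market =
  banks :: "'a set"
  lenders :: "'a set"
  borrowers :: "'a set"
  base_rate :: "'a \<Rightarrow> real"
  reservation_rate :: "'a \<Rightarrow> real"
  default_prob :: "'a \<Rightarrow> real"
  maturity :: nat

definition wf_market :: "'a market \<Rightarrow> bool" where
  "wf_market M \<longleftrightarrow>
     finite (banks M) \<and> lenders M \<subseteq> banks M \<and> borrowers M \<subseteq> banks M \<and>
     lenders M \<inter> borrowers M = {} \<and>
     inj_on (base_rate M) (lenders M) \<and>
     (\<forall>j\<in>borrowers M. 0 \<le> default_prob M j \<and> default_prob M j < 1) \<and>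
     maturity M \<ge> 1"

definition risk_premium :: "'a market \<Rightarrow> 'a \<Rightarrow> 'a \<Rightarrow> real" where
  "risk_premium M i j =
     (1 + base_rate M i) / (1 - default_prob M j) powr (1 / real (maturity M))
       - 1 - base_rate M i"

definition rate :: "'a market \<Rightarrow> real \<Rightarrow> 'a \<Rightarrow> 'a \<Rightarrow> real" where
  "rate M \<kappa> i j = base_rate M i + risk_premium M i j + \<kappa>"

text \<open>Preference profiles are weak: \<open>P a x y\<close> means that bank \<open>a\<close> finds option \<open>x\<close> at
  least as good as option \<open>y\<close>. For a borrower \<open>j\<close>, the option \<open>j\<close> is staying unmatched.\<close>

definition strictly_prefers :: "('a \<Rightarrow> 'a \<Rightarrow> 'a \<Rightarrow> bool) \<Rightarrow> 'a \<Rightarrow> 'a \<Rightarrow> 'a \<Rightarrow> bool" where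
  "strictly_prefers P a x y \<longleftrightarrow> P a x y \<and> \<not> P a y x"

definition indifferent :: "('a \<Rightarrow> 'a \<Rightarrow> 'a \<Rightarrow> bool) \<Rightarrow> 'a \<Rightarrow> 'a \<Rightarrow> 'a \<Rightarrow> bool" where
  "indifferent P a x y \<longleftrightarrow> P a x y \<and> P a y x"

definition option_rate :: "'a market \<Rightarrow> real \<Rightarrow> 'a \<Rightarrow> 'a \<Rightarrow> real" where
  "option_rate M \<kappa> j x = (if x = j then reservation_rate M j else rate M \<kappa> x j)"

text \<open>Lenders are indifferent among all borrowers. How a lender ranks staying unmatched
  is immaterial: stability only ever compares borrowers on the lenders' side.\<close>

definition prefs :: "'a market \<Rightarrow> real \<Rightarrow> 'a \<Rightarrow> 'a \<Rightarrow> 'a \<Rightarrow> bool" where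
  "prefs M \<kappa> a x y \<longleftrightarrow>
     (a \<in> borrowers M \<longrightarrow> option_rate M \<kappa> a x \<le> option_rate M \<kappa> a y)"

text \<open>\<open>permutes\<close> makes a matching the identity outside the set of banks, so that distinct
  functions are distinct matchings.\<close>

definition matching :: "'a market \<Rightarrow> ('a \<Rightarrow> 'a) \<Rightarrow> bool" where
  "matching M \<mu> \<longleftrightarrow>
     \<mu> permutes banks M \<and>
     (\<forall>a\<in>banks M. \<mu> (\<mu> a) = a) \<and>
     (\<forall>b\<in>borrowers M. \<mu> b \<noteq> b \<longrightarrow> \<mu> b \<in> lenders M) \<and>
     (\<forall>l\<in>lenders M. \<mu> l \<noteq> l \<longrightarrow> \<mu> l \<in> borrowers M)"

definition volume :: "'a market \<Rightarrow> ('a \<Rightarrow> 'a) \<Rightarrow> real" where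
  "volume M \<mu> = 1 / 2 * (\<Sum>i\<in>lenders M \<union> borrowers M. of_bool (\<mu> i \<noteq> i))"

definition pairwise_stable ::
    "'a market \<Rightarrow> ('a \<Rightarrow> 'a \<Rightarrow> 'a \<Rightarrow> bool) \<Rightarrow> ('a \<Rightarrow> 'a) \<Rightarrow> bool" where
  "pairwise_stable M P \<mu> \<longleftrightarrow>
     (\<forall>i\<in>lenders M. \<forall>l\<in>lenders M. \<forall>k\<in>borrowers M. \<forall>j\<in>borrowers M.
        \<mu> i = j \<and> \<mu> k = l \<longrightarrow>
        \<not> (strictly_prefers P i k j \<and> strictly_prefers P k i l))"

text \<open>A coalitional deviation is a swap of counter-parties inside a nonempty group of matched
  borrowers: the group keeps, as a whole, the same set of lenders. If \<open>\<mu>'\<close> could be any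
  other matching, the singleton group \<open>{j}\<close> could take a lender away from a borrower outside
  the group; and for the empty group any other matching would be a deviation.\<close>

definition coalitionally_stable ::
    "'a market \<Rightarrow> ('a \<Rightarrow> 'a \<Rightarrow> 'a \<Rightarrow> bool) \<Rightarrow> ('a \<Rightarrow> 'a) \<Rightarrow> bool" where
  "coalitionally_stable M P \<mu> \<longleftrightarrow>
     (\<forall>b. b \<subseteq> borrowers M \<and> b \<noteq> {} \<and> \<mu> ` b \<subseteq> lenders M \<and>
          (\<forall>j\<in>b. \<forall>k\<in>b. indifferent P (\<mu> j) j k) \<longrightarrow>
        \<not> (\<exists>\<mu>'. matching M \<mu>' \<and> \<mu>' \<noteq> \<mu> \<and> \<mu>' ` b = \<mu> ` b \<and>
               (\<forall>j\<in>b. strictly_prefers P j (\<mu>' j) (\<mu> j))))"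

definition unilaterally_stable ::
    "'a market \<Rightarrow> ('a \<Rightarrow> 'a \<Rightarrow> 'a \<Rightarrow> bool) \<Rightarrow> ('a \<Rightarrow> 'a) \<Rightarrow> bool" where
  "unilaterally_stable M P \<mu> \<longleftrightarrow>
     (\<forall>j\<in>borrowers M. \<mu> j \<noteq> j \<longrightarrow> \<not> strictly_prefers P j j (\<mu> j)) \<and>
     (\<forall>j\<in>borrowers M. \<forall>k\<in>lenders M. \<mu> k = k \<longrightarrow> \<not> strictly_prefers P j k (\<mu> j))"

definition stable_matching ::
    "'a market \<Rightarrow> ('a \<Rightarrow> 'a \<Rightarrow> 'a \<Rightarrow> bool) \<Rightarrow> ('a \<Rightarrow> 'a) \<Rightarrow> bool" where
  "stable_matching M P \<mu> \<longleftrightarrow>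
     matching M \<mu> \<and> pairwise_stable M P \<mu> \<and> coalitionally_stable M P \<mu> \<and>
     unilaterally_stable M P \<mu>"

text \<open>The rate conditions only speak about matched pairs, so they hold for the matching that
  leaves every bank unmatched; such a matching need not be stable.\<close>

definition EQ :: "'a market \<Rightarrow> real \<Rightarrow> ('a \<Rightarrow> 'a) set" where
  "EQ M \<kappa> = {\<mu>. matching M \<mu> \<and>
     (\<forall>i\<in>lenders M. \<forall>j\<in>borrowers M. \<mu> i = j \<longrightarrow>
        rate M \<kappa> i j < reservation_rate M j \<and>
        (\<forall>m\<in>lenders M. \<mu> m = m \<longrightarrow> rate M \<kappa> i j < rate M \<kappa> m j))}"

definition stable_EQ :: "'a market \<Rightarrow> real \<Rightarrow> ('a \<Rightarrow> 'a) set" where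
  "stable_EQ M \<kappa> = {\<mu> \<in> EQ M \<kappa>. stable_matching M (prefs M \<kappa>) \<mu>}"

end

theory Submission imports Defs begin

text \<open>A lender's rate for a fixed borrower is a strictly increasing function of the base rate. Hence
  in a swap inside a group of borrowers the one holding the cheapest lender cannot gain, and the tax
  enters the equilibrium conditions only through the reservation rates, so equilibria of the taxed
  market are equilibria of the untaxed one. If an equilibrium leaves unmatched a borrower and
  a lender who could trade, matching this borrower to the cheapest unmatched lender gives an
  equilibrium of larger volume. So an equilibrium of maximal volume is stable, and the two maxima
  over \<open>EQ\<close> and \<open>stable_EQ\<close> coincide.\<close>

text \<open>The base rate cancels against the risk premium, leaving \<open>1 + base_rate M i\<close>
  over a positive factor that depends only on \<open>j\<close>, plus a constant. So all borrowers
  rank lenders alike, whatever the tax.\<close>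

lemma rate_less_iff:
  assumes "wf_market M" "j \<in> borrowers M"
  shows "rate M \<kappa> i j < rate M \<kappa> k j \<longleftrightarrow> base_rate M i < base_rate M k"
proof -
  have "(1 - default_prob M j) powr (1 / real (maturity M)) > 0"
    using assms by (auto simp: wf_market_def)
  then show ?thesis
    by (simp add: rate_def risk_premium_def divide_less_cancel)
qed

lemma prefs_borrower:
  assumes "j \<in> borrowers M"
  shows "strictly_prefers (prefs M \<kappa>) j x y \<longleftrightarrow> option_rate M \<kappa> j x < option_rate M \<kappa> j y"
  using assms by (auto simp: strictly_prefers_def prefs_def)

text \<open>\<open>prefs\<close> is trivially true for banks that are not borrowers. This rules out
  every pairwise deviation.\<close>

lemma prefs_lender:
  assumes "wf_market M" "i \<in> lenders M"
  shows "\<not> strictly_prefers (prefs M \<kappa>) i x y"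
  using assms by (auto simp: strictly_prefers_def prefs_def wf_market_def)

text \<open>Outside \<open>banks M\<close> a matching is the identity, so the involution law extends
  to the whole type.\<close>

lemma matching_invol:
  assumes "matching M \<mu>"
  shows "\<mu> (\<mu> a) = a"
  using assms unfolding matching_def permutes_def by metis

lemma finite_market:
  assumes "wf_market M"
  shows "finite (lenders M)" "finite (borrowers M)"
  using assms by (auto simp: wf_market_def intro: finite_subset)

lemma EQ_matching: "\<mu> \<in> EQ M \<kappa> \<Longrightarrow> matching M \<mu>"
  by (simp add: EQ_def)

lemma EQ_reservation:
  assumes "\<mu> \<in> EQ M \<kappa>" "j \<in> borrowers M" "\<mu> j \<noteq> j"
  shows "rate M \<kappa> (\<mu> j) j < reservation_rate M j"
proof -
  have "\<mu> j \<in> lenders M" "\<mu> (\<mu> j) = j"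
    using EQ_matching[OF assms(1)] assms(2,3) matching_invol[OF EQ_matching[OF assms(1)]]
    by (auto simp: matching_def)
  then show ?thesis
    using assms unfolding EQ_def by blast
qed

lemma EQ_cheaper_than_unmatched:
  assumes "\<mu> \<in> EQ M \<kappa>" "j \<in> borrowers M" "\<mu> j \<noteq> j" "m \<in> lenders M" "\<mu> m = m"
  shows "rate M \<kappa> (\<mu> j) j < rate M \<kappa> m j"
proof -
  have "\<mu> j \<in> lenders M" "\<mu> (\<mu> j) = j"
    using EQ_matching[OF assms(1)] assms(2,3) matching_invol[OF EQ_matching[OF assms(1)]]
    by (auto simp: matching_def)
  then show ?thesis
    using assms unfolding EQ_def by blast
qed

lemma coalitionally_stable_prefs:
  assumes wf: "wf_market M"
  shows "coalitionally_stable M (prefs M \<kappa>) \<mu>"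
  unfolding coalitionally_stable_def
proof (intro allI impI notI, elim conjE exE)
  fix b \<mu>'
  assume b: "b \<subseteq> borrowers M" "b \<noteq> {}" "\<mu> ` b \<subseteq> lenders M" "\<mu>' ` b = \<mu> ` b"
    and gain: "\<forall>j\<in>b. strictly_prefers (prefs M \<kappa>) j (\<mu>' j) (\<mu> j)"
  have "finite b"
    using b(1) finite_market(2)[OF wf] by (rule finite_subset)
  \<comment> \<open>\<open>j\<close> is the member of the group that already holds its cheapest
    lender.\<close>
  then obtain j where j: "j \<in> b" "\<And>k. k \<in> b \<Longrightarrow> base_rate M (\<mu> j) \<le> base_rate M (\<mu> k)"
    using b(2) arg_min_if_finite(1)[of b "base_rate M \<circ> \<mu>"] arg_min_least[of b _ "base_rate M \<circ> \<mu>"]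
    by fastforce
  \<comment> \<open>The group keeps its set of lenders, so the new partner of \<open>j\<close> is
    the old one of some member \<open>k\<close>.\<close>
  from j(1) b(4) obtain k where k: "k \<in> b" "\<mu>' j = \<mu> k"
    by (metis imageE imageI)
  \<comment> \<open>Both partners are lenders and \<open>j\<close> is a borrower, so
    \<open>option_rate\<close> compares two loan rates, not the reservation rate.\<close>
  have "\<mu> j \<noteq> j" "\<mu>' j \<noteq> j"
    using j(1) k b(1,3) wf unfolding wf_market_def by (metis disjoint_iff image_subset_iff subsetD)+
  then have "rate M \<kappa> (\<mu> k) j < rate M \<kappa> (\<mu> j) j"
    using bspec[OF gain j(1)] j(1) k(2) b(1) by (simp add: prefs_borrower option_rate_def subset_eq)
  then have "base_rate M (\<mu> k) < base_rate M (\<mu> j)"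
    using rate_less_iff[OF wf] j(1) b(1) by blast
  with j(2)[OF k(1)] show False by simp
qed

text \<open>The conditions in \<open>EQ\<close> protect only matched borrowers.
  \<open>no_block\<close> covers the remaining unilateral deviation: an unmatched borrower turning
  to an unmatched lender.\<close>

lemma EQ_imp_stable_matching:
  assumes wf: "wf_market M" and eq: "\<mu> \<in> EQ M \<kappa>"
    and no_block: "\<And>j m. \<lbrakk>j \<in> borrowers M; m \<in> lenders M; \<mu> j = j; \<mu> m = m\<rbrakk>
      \<Longrightarrow> \<not> rate M \<kappa> m j < reservation_rate M j"
  shows "stable_matching M (prefs M \<kappa>) \<mu>"
proof -
  have "pairwise_stable M (prefs M \<kappa>) \<mu>"
    using prefs_lender[OF wf] by (auto simp: pairwise_stable_def)
  moreover have "\<not> strictly_prefers (prefs M \<kappa>) j j (\<mu> j)"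
    if "j \<in> borrowers M" "\<mu> j \<noteq> j" for j
    using EQ_reservation[OF eq that] that by (auto simp: prefs_borrower option_rate_def)
  moreover have "\<not> strictly_prefers (prefs M \<kappa>) j k (\<mu> j)"
    if "j \<in> borrowers M" "k \<in> lenders M" "\<mu> k = k" for j k
  proof -
    have "k \<noteq> j"
      using wf that by (auto simp: wf_market_def)
    then show ?thesis
      using no_block[OF that(1,2) _ that(3)] EQ_cheaper_than_unmatched[OF eq that(1) _ that(2,3)] that
      by (cases "\<mu> j = j") (auto simp: prefs_borrower option_rate_def)
  qed
  ultimately show ?thesis
    using EQ_matching[OF eq] coalitionally_stable_prefs[OF wf]
    by (auto simp: stable_matching_def unilaterally_stable_def)
qed

text \<open>The tax cancels in comparisons between lenders, and lowering it only relaxes the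
  reservation constraint.\<close>

lemma EQ_antimono:
  assumes "\<kappa> \<le> \<kappa>'"
  shows "EQ M \<kappa>' \<subseteq> EQ M \<kappa>"
  using assms by (force simp: EQ_def rate_def)

lemma finite_EQ:
  assumes "wf_market M"
  shows "finite (EQ M \<kappa>)"
  using assms finite_permutations[of "banks M"]
  by (auto simp: wf_market_def EQ_def matching_def intro: rev_finite_subset)

text \<open>With nobody matched the rate conditions are vacuous. Together with finiteness this gives
  \<open>Max\<close> over volumes its intended meaning.\<close>

lemma EQ_nonempty:
  assumes "wf_market M"
  shows "EQ M \<kappa> \<noteq> {}"
proof -
  have "id \<in> EQ M \<kappa>"
    using assms by (auto simp: EQ_def matching_def wf_market_def permutes_id)
  then show ?thesis by blast
qed

lemma matching_add_pair:
  assumes wf: "wf_market M" and mt: "matching M \<mu>"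
    and j: "j \<in> borrowers M" "\<mu> j = j" and m: "m \<in> lenders M" "\<mu> m = m"
  shows "matching M (\<mu>(m := j, j := m))"
proof -
  let ?\<nu> = "\<mu>(m := j, j := m)"
  note invol = matching_invol[OF mt]
  have invol': "?\<nu> (?\<nu> a) = a" for a
    proof (cases "a = j \<or> a = m")
    case False
    then have "\<mu> a \<noteq> j" "\<mu> a \<noteq> m"
      using invol[of a] j(2) m(2) by auto
    then show ?thesis
      using False invol[of a] by simp
  qed auto
  have "?\<nu> permutes banks M"
    unfolding permutes_def
  proof (intro conjI allI impI)
    fix x assume "x \<notin> banks M"
    then show "?\<nu> x = x"
      using mt wf j m by (auto simp: matching_def permutes_def wf_market_def)
  next
    \<comment> \<open>An involution is bijective: the only preimage of \<open>y\<close> is its own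
      image.\<close>
    fix y show "\<exists>!x. ?\<nu> x = y"
      using invol' by metis
  qed
  then show ?thesis
    using mt invol' j m wf unfolding matching_def wf_market_def by auto
qed

lemma volume_add_pair:
  assumes "wf_market M" "j \<in> borrowers M" "\<mu> j = j" "m \<in> lenders M" "\<mu> m = m"
  shows "volume M \<mu> < volume M (\<mu>(m := j, j := m))"
proof -
  have "j \<noteq> m"
    using assms by (auto simp: wf_market_def)
  \<comment> \<open>No bank loses its matched status, and the summand at \<open>j\<close> rises from
    0 to 1.\<close>
  then have "(\<Sum>i\<in>lenders M \<union> borrowers M. of_bool (\<mu> i \<noteq> i) :: real)
      < (\<Sum>i\<in>lenders M \<union> borrowers M. of_bool ((\<mu>(m := j, j := m)) i \<noteq> i))"
    using assms finite_market[OF assms(1)]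
    by (intro sum_strict_mono_ex1) (auto intro!: bexI[of _ j])
  then show ?thesis
    by (simp add: volume_def)
qed

lemma EQ_add_cheapest:
  assumes wf: "wf_market M" and eq: "\<mu> \<in> EQ M \<kappa>"
    and j: "j \<in> borrowers M" "\<mu> j = j" and m: "m \<in> lenders M" "\<mu> m = m"
    and res: "rate M \<kappa> m j < reservation_rate M j"
    and cheapest: "\<And>k. \<lbrakk>k \<in> lenders M; \<mu> k = k\<rbrakk> \<Longrightarrow> base_rate M m \<le> base_rate M k"
  shows "\<mu>(m := j, j := m) \<in> EQ M \<kappa>"
proof -
  let ?\<nu> = "\<mu>(m := j, j := m)"
  have disj: "lenders M \<inter> borrowers M = {}"
    using wf by (simp add: wf_market_def)
  have "rate M \<kappa> i b < reservation_rate M b \<and>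
      (\<forall>k\<in>lenders M. ?\<nu> k = k \<longrightarrow> rate M \<kappa> i b < rate M \<kappa> k b)"
    if i: "i \<in> lenders M" and b: "b \<in> borrowers M" and ib: "?\<nu> i = b" for i b
  proof (cases "i = m")
    case True
    then have "b = j"
      using ib disj i j by (auto split: if_splits)
    moreover have "rate M \<kappa> m j < rate M \<kappa> k j" if k: "k \<in> lenders M" "?\<nu> k = k" for k
    proof -
      \<comment> \<open>Distinct base rates turn the weak minimality of \<open>m\<close> into the
        strict inequality that \<open>EQ\<close> demands of the new pair.\<close>
      have "k \<noteq> m" "\<mu> k = k"
        using k m disj j by (auto split: if_splits)
      moreover have "inj_on (base_rate M) (lenders M)"
        using wf by (simp add: wf_market_def)
      ultimately have "base_rate M m < base_rate M k"
        using cheapest[of k] k(1) m(1) by (fastforce simp: inj_on_def order_le_less)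
      then show ?thesis
        using rate_less_iff[OF wf j(1)] by blast
    qed
    ultimately show ?thesis
      using res True by simp
  next
    case False
    then have "\<mu> i = b"
      using ib disj i j by (auto split: if_splits)
    \<comment> \<open>For the old pairs the set of unmatched lenders only shrinks, so their
      conditions persist.\<close>
    moreover have "\<mu> k = k" if "k \<in> lenders M" "?\<nu> k = k" for k
      using that m disj j by (auto split: if_splits)
    ultimately show ?thesis
      using eq i b unfolding EQ_def by blast
  qed
  then show ?thesis
    using matching_add_pair[OF wf EQ_matching[OF eq] j m] unfolding EQ_def by blast
qed

lemma max_volume_stable:
  assumes wf: "wf_market M" and eq: "\<mu> \<in> EQ M \<kappa>"
    and max: "\<And>\<nu>. \<nu> \<in> EQ M \<kappa> \<Longrightarrow> volume M \<nu> \<le> volume M \<mu>"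
  shows "stable_matching M (prefs M \<kappa>) \<mu>"
proof (rule EQ_imp_stable_matching[OF wf eq], rule notI)
  fix j m
  assume j: "j \<in> borrowers M" "\<mu> j = j" and m: "m \<in> lenders M" "\<mu> m = m"
    and res: "rate M \<kappa> m j < reservation_rate M j"
  let ?U = "{k \<in> lenders M. \<mu> k = k}"
  have "finite ?U" "?U \<noteq> {}"
    using finite_market(1)[OF wf] m by auto
  \<comment> \<open>The blocking lender \<open>m\<close> need not be the cheapest unmatched one; the
    cheapest, \<open>n\<close>, is at most as expensive for \<open>j\<close> and hence acceptable
    too.\<close>
  then obtain n where n: "n \<in> ?U" "\<And>k. k \<in> ?U \<Longrightarrow> base_rate M n \<le> base_rate M k"
    using arg_min_if_finite(1)[of ?U "base_rate M"] arg_min_least[of ?U _ "base_rate M"] by blast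
  have "rate M \<kappa> n j \<le> rate M \<kappa> m j"
    using n(2)[of m] m rate_less_iff[OF wf j(1), of \<kappa> m n] by auto
  then have "\<mu>(n := j, j := n) \<in> EQ M \<kappa>"
    using EQ_add_cheapest[OF wf eq j, of n] n res by auto
  moreover have "volume M \<mu> < volume M (\<mu>(n := j, j := n))"
    using volume_add_pair[of M j \<mu> n] wf j n(1) by auto
  ultimately show False
    using max by fastforce
qed

lemma stable_EQ_max_volume:
  assumes wf: "wf_market M"
  shows "stable_EQ M \<kappa> \<noteq> {}"
    and "Max (volume M ` stable_EQ M \<kappa>) = Max (volume M ` EQ M \<kappa>)"
proof -
  have fin: "finite (volume M ` EQ M \<kappa>)"
    using finite_EQ[OF wf] by blast
  then have "Max (volume M ` EQ M \<kappa>) \<in> volume M ` EQ M \<kappa>"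
    using EQ_nonempty[OF wf] by (intro Max_in) auto
  then obtain \<mu> where \<mu>: "\<mu> \<in> EQ M \<kappa>" "volume M \<mu> = Max (volume M ` EQ M \<kappa>)"
    by auto
  have max: "volume M \<nu> \<le> volume M \<mu>" if "\<nu> \<in> EQ M \<kappa>" for \<nu>
    using \<mu>(2) that fin by simp
  \<comment> \<open>The maximizer over the larger set lies in the smaller one, so the maxima
    agree.\<close>
  have mem: "\<mu> \<in> stable_EQ M \<kappa>"
    using max_volume_stable[OF wf \<mu>(1) max] \<mu>(1) by (simp add: stable_EQ_def)
  then show "stable_EQ M \<kappa> \<noteq> {}" by blast
  have sub: "stable_EQ M \<kappa> \<subseteq> EQ M \<kappa>"
    by (auto simp: stable_EQ_def)
  have "Max (volume M ` stable_EQ M \<kappa>) = volume M \<mu>"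
    using mem max sub finite_subset[OF sub finite_EQ[OF wf]] by (intro Max_eqI) auto
  then show "Max (volume M ` stable_EQ M \<kappa>) = Max (volume M ` EQ M \<kappa>)"
    using \<mu>(2) by simp
qed

text \<open>Stability is claimed under a premise excluding acceptable unmatched pairs, since the
  empty matching lies in \<open>EQ\<close> even when such a pair blocks it. The volume bound is
  given for both readings of the equilibrium set, \<open>EQ\<close> and
  \<open>stable_EQ\<close>.\<close>

theorem proposition2:
  fixes M :: "'a market" and \<kappa> :: real
  assumes "wf_market M" and "\<kappa> \<ge> 0"
  shows
    "(\<forall>\<mu>\<in>EQ M \<kappa>.
        (\<forall>j\<in>borrowers M. \<forall>m\<in>lenders M. \<mu> j = j \<and> \<mu> m = m \<longrightarrow>
           \<not> rate M \<kappa> m j < reservation_rate M j) \<longrightarrow>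
        stable_matching M (prefs M \<kappa>) \<mu>) \<and>
     Max (volume M ` EQ M \<kappa>) \<le> Max (volume M ` EQ M 0) \<and>
     stable_EQ M \<kappa> \<noteq> {} \<and>
     Max (volume M ` stable_EQ M \<kappa>) \<le> Max (volume M ` stable_EQ M 0)"
proof -
  have le: "Max (volume M ` EQ M \<kappa>) \<le> Max (volume M ` EQ M 0)"
    using EQ_antimono[OF assms(2)] EQ_nonempty[OF assms(1)] finite_EQ[OF assms(1)]
    by (intro Max_mono) auto
  then show ?thesis
    using EQ_imp_stable_matching[OF assms(1)] stable_EQ_max_volume[OF assms(1)] by simp
qed

end
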